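(* Let $g(t)=\sum_{k\ge 0}g_k\frac{t^k}{k!}$ with $g_0\ne 0$ and $f(z)=\sum_{k\ge 1}f_k\frac{z^k}{k!}$ with $f_1=1$ be formal power series with complex coefficients, and let $\tilde f$ be the inverse of $f$ under composition. Let $A=g(D)$, $B=F C_f F^{-1}$, and let $S=BA$ be the corresponding Sheffer matrix. Let $M_S=S^{-1}XS$ and $P_S=S^{-1}DS$. Then $$M_S=\left(\frac{1}{\tilde f'}\right)(D)\left(\left(\frac{g'}{g}\right)(D)+X\right),\qquad P_S=\tilde f(D),$$ and therefore $$P_SM_S=\left(\frac{\tilde f}{\tilde f'}\right)(D)\left(\left(\frac{g'}{g}\right)(D)+X\right).$$
   Context: All matrices are infinite complex matrices $[a_{j,k}]$ with indices running over the non-negative integers, and all those considered satisfy $a_{j,k}=0$ whenever $j-k<m$ for some integer $m$ depending on the matrix, so that products involve only finite sums. $X$ is the matrix with $X_{j,j+1}=1$ for $j\ge 0$ and all other entries zero. $D$ is the matrix with $D_{k+1,k}=k+1$ for $k\ge 0$ and all other entries zero. $F$ is the diagonal matrix $\mathrm{Diag}(0!,1!,2!,\ldots)$. For a formal power series $f(z)$ with zero constant term, the composition matrix $C_f$ is the lower triangular matrix whose $(k,n)$ entry is the coefficient of $z^k$ in $f(z)^n$. The compositional inverse $\tilde f$ satisfies $f(\tilde f(z))=z=\tilde f(f(z))$. For a formal power series $a(t)=\sum_{k\ge 0}a_k\frac{t^k}{k!}$, $a(D)=\sum_{k\ge 0}a_k\frac{D^k}{k!}$ (a well-defined lower triangular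 matrix, with $D^0=I$ the identity). Primes denote formal derivatives and quotients are taken in the algebra of formal power series. The inverse $S^{-1}$ is the inverse of $S$ in the group of lower triangular matrices with all diagonal entries nonzero. *)

theory Defs
  imports
    "HOL-Library.Groups_Big_Fun"
    "HOL-Computational_Algebra.Formal_Power_Series"
    "HOL-Algebra.Group"
begin

definition bounded_above_diagonal :: "(nat \<Rightarrow> nat \<Rightarrow> complex) \<Rightarrow> bool" where
  "bounded_above_diagonal a \<longleftrightarrow> (\<exists>m::int. \<forall>j k. int j - int k < m \<longrightarrow> a j k = 0)"

lemma bounded_above_diagonalI:
  assumes "\<And>j k. int j - int k < m \<Longrightarrow> a j k = 0"
  shows "bounded_above_diagonal a"
  using assms unfolding bounded_above_diagonal_def by blast

lemma bounded_above_diagonal_row: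
  assumes "bounded_above_diagonal a"
  shows "finite {k. a j k \<noteq> 0}"
proof -
  obtain m :: int where m: "\<And>j k. int j - int k < m \<Longrightarrow> a j k = 0"
    using assms unfolding bounded_above_diagonal_def by blast
  have "{k. a j k \<noteq> 0} \<subseteq> {..nat (int j - m)}"
    using m by (force simp: not_less)
  then show ?thesis
    using finite_subset by blast
qed

typedef imat = "{a. bounded_above_diagonal a}"
  morphisms entry Imat
proof
  show "(\<lambda>_ _. 0) \<in> {a. bounded_above_diagonal a}"
    by (simp add: bounded_above_diagonal_def)
qed

setup_lifting type_definition_imat

lemma entry_bounded: "bounded_above_diagonal (entry A)"
  using entry by simp

lemma finite_row [simp]: "finite {k. entry A j k \<noteq> 0}"
  by (rule bounded_above_diagonal_row [OF entry_bounded])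

lemma imat_eqI: "(\<And>j k. entry A j k = entry B j k) \<Longrightarrow> A = B"
  by (metis entry_inject ext)

instantiation imat :: ring_1
begin

lift_definition zero_imat :: imat is "\<lambda>_ _. 0"
  by (simp add: bounded_above_diagonal_def)

lift_definition one_imat :: imat is "\<lambda>j k. if j = k then 1 else 0"
  by (rule bounded_above_diagonalI [where m = 0]) auto

lift_definition plus_imat :: "imat \<Rightarrow> imat \<Rightarrow> imat" is "\<lambda>a b j k. a j k + b j k"
proof -
  fix a b :: "nat \<Rightarrow> nat \<Rightarrow> complex"
  assume "bounded_above_diagonal a" "bounded_above_diagonal b"
  then obtain m n where "\<And>j k. int j - int k < m \<Longrightarrow> a j k = 0"
    and "\<And>j k. int j - int k < n \<Longrightarrow> b j k = 0"
    unfolding bounded_above_diagonal_def by blast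
  then show "bounded_above_diagonal (\<lambda>j k. a j k + b j k)"
    by (intro bounded_above_diagonalI [where m = "min m n"]) auto
qed

lift_definition uminus_imat :: "imat \<Rightarrow> imat" is "\<lambda>a j k. - a j k"
  by (simp add: bounded_above_diagonal_def)

definition minus_imat :: "imat \<Rightarrow> imat \<Rightarrow> imat" where
  "minus_imat A B = A + (- B)"

lift_definition times_imat :: "imat \<Rightarrow> imat \<Rightarrow> imat" is
  "\<lambda>a b j k. Sum_any (\<lambda>l. a j l * b l k)"
proof -
  fix a b :: "nat \<Rightarrow> nat \<Rightarrow> complex"
  assume "bounded_above_diagonal a" "bounded_above_diagonal b"
  then obtain m n where m: "\<And>j k. int j - int k < m \<Longrightarrow> a j k = 0"
    and n: "\<And>j k. int j - int k < n \<Longrightarrow> b j k = 0"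
    unfolding bounded_above_diagonal_def by blast
  have "a j l * b l k = 0" if "int j - int k < m + n" for j k l
    using that m [of j l] n [of l k] by (cases "int j - int l < m") auto
  then show "bounded_above_diagonal (\<lambda>j k. Sum_any (\<lambda>l. a j l * b l k))"
    by (intro bounded_above_diagonalI [where m = "m + n"]) (simp del: mult_eq_0_iff)
qed

lemma entry_times:
  assumes "finite R" "{l. entry A j l \<noteq> 0} \<subseteq> R"
  shows "entry (A * B) j k = (\<Sum>l\<in>R. entry A j l * entry B l k)"
  unfolding times_imat.rep_eq
  by (rule Sum_any.expand_superset) (use assms in auto)

instance
proof
  fix A B C :: imat
  show "A + B + C = A + (B + C)" "A + B = B + A" "0 + A = A" "- A + A = 0" "A - B = A + - B"
    by (auto intro!: imat_eqI simp: plus_imat.rep_eq zero_imat.rep_eq uminus_imat.rep_eq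
        minus_imat_def)
  show "(0::imat) \<noteq> 1"
  proof
    assume "(0::imat) = 1"
    then have "entry 0 0 0 = entry 1 0 0" by simp
    then show False by (simp add: zero_imat.rep_eq one_imat.rep_eq)
  qed
  show "A * (B + C) = A * B + A * C"
    by (rule imat_eqI)
      (simp add: entry_times [OF finite_row order_refl] plus_imat.rep_eq sum.distrib algebra_simps)
  show "(A + B) * C = A * C + B * C"
  proof (rule imat_eqI)
    fix j k
    let ?R = "{l. entry A j l \<noteq> 0} \<union> {l. entry B j l \<noteq> 0}"
    have "entry (A * C) j k = (\<Sum>l\<in>?R. entry A j l * entry C l k)"
      and "entry (B * C) j k = (\<Sum>l\<in>?R. entry B j l * entry C l k)"
      and "entry ((A + B) * C) j k = (\<Sum>l\<in>?R. entry (A + B) j l * entry C l k)"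
      by (intro entry_times; auto simp: plus_imat.rep_eq)+
    then show "entry ((A + B) * C) j k = entry (A * C + B * C) j k"
      by (simp add: plus_imat.rep_eq sum.distrib algebra_simps)
  qed
  show "1 * A = A"
  proof (rule imat_eqI)
    fix j k
    have "entry (1 * A) j k = (\<Sum>l\<in>{j}. entry 1 j l * entry A l k)"
      by (rule entry_times) (auto simp: one_imat.rep_eq split: if_splits)
    then show "entry (1 * A) j k = entry A j k"
      by (simp add: one_imat.rep_eq)
  qed
  show "A * 1 = A"
  proof (rule imat_eqI)
    fix j k
    let ?R = "insert k {l. entry A j l \<noteq> 0}"
    have "entry (A * 1) j k = (\<Sum>l\<in>?R. entry A j l * entry 1 l k)"
      by (rule entry_times) auto
    also have "\<dots> = (\<Sum>l\<in>?R. if l = k then entry A j l else 0)"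
      by (intro sum.cong) (auto simp: one_imat.rep_eq)
    also have "\<dots> = entry A j k"
      by (subst sum.delta) auto
    finally show "entry (A * 1) j k = entry A j k" .
  qed
  show "A * B * C = A * (B * C)"
  proof (rule imat_eqI)
    fix j k
    let ?R = "{l. entry A j l \<noteq> 0}"
    let ?Q = "\<Union>l\<in>?R. {q. entry B l q \<noteq> 0}"
    have sub: "{q. entry (A * B) j q \<noteq> 0} \<subseteq> ?Q"
    proof
      fix q
      assume "q \<in> {q. entry (A * B) j q \<noteq> 0}"
      then have "(\<Sum>l\<in>?R. entry A j l * entry B l q) \<noteq> 0"
        by (simp add: entry_times [OF finite_row order_refl])
      then obtain l where "l \<in> ?R" "entry A j l * entry B l q \<noteq> 0"
        by (meson sum.neutral)
      then show "q \<in> ?Q" by auto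
    qed
    have fin: "finite ?Q" by simp
    have "entry (A * B * C) j k = (\<Sum>q\<in>?Q. entry (A * B) j q * entry C q k)"
      by (rule entry_times [OF fin sub])
    also have "\<dots> = (\<Sum>q\<in>?Q. \<Sum>l\<in>?R. entry A j l * entry B l q * entry C q k)"
      by (simp add: entry_times [OF finite_row order_refl] sum_distrib_right)
    also have "\<dots> = (\<Sum>l\<in>?R. \<Sum>q\<in>?Q. entry A j l * entry B l q * entry C q k)"
      by (rule sum.swap)
    also have "\<dots> = (\<Sum>l\<in>?R. entry A j l * entry (B * C) l k)"
    proof (rule sum.cong [OF refl])
      fix l
      assume "l \<in> ?R"
      then have "{q. entry B l q \<noteq> 0} \<subseteq> ?Q" by blast
      then have "entry (B * C) l k = (\<Sum>q\<in>?Q. entry B l q * entry C q k)"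
        by (rule entry_times [OF fin])
      then show "(\<Sum>q\<in>?Q. entry A j l * entry B l q * entry C q k) = entry A j l * entry (B * C) l k"
        by (simp add: sum_distrib_left mult.assoc)
    qed
    also have "\<dots> = entry (A * (B * C)) j k"
      by (rule entry_times [OF finite_row order_refl, symmetric])
    finally show "entry (A * B * C) j k = entry (A * (B * C)) j k" .
  qed
qed

end

definition lower_triangular :: "imat \<Rightarrow> bool" where
  "lower_triangular A \<longleftrightarrow> (\<forall>j k. j < k \<longrightarrow> entry A j k = 0)"

lemma lower_triangular_one: "lower_triangular 1"
  by (simp add: lower_triangular_def one_imat.rep_eq)

lemma lower_triangular_times:
  assumes "lower_triangular A" "lower_triangular B"
  shows "lower_triangular (A * B)"
  unfolding lower_triangular_def
proof (intro allI impI)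
  fix j k :: nat
  assume "j < k"
  then have "entry A j l * entry B l k = 0" for l
    using assms by (cases "j < l") (auto simp: lower_triangular_def)
  then show "entry (A * B) j k = 0"
    by (simp add: times_imat.rep_eq del: mult_eq_0_iff)
qed

lemma lower_triangular_power: "lower_triangular A \<Longrightarrow> lower_triangular (A ^ n)"
  by (induction n) (auto intro: lower_triangular_one lower_triangular_times)

definition lower_triangular_group :: "imat monoid" where
  "lower_triangular_group =
    \<lparr>carrier = {A. lower_triangular A \<and> (\<forall>n. entry A n n \<noteq> 0)}, mult = (*), one = 1\<rparr>"

lift_definition X_mat :: imat is "\<lambda>j k. if k = j + 1 then 1 else 0"
  by (rule bounded_above_diagonalI [where m = "-1"]) auto

lift_definition D_mat :: imat is "\<lambda>j k. if j = k + 1 then of_nat (k + 1) else 0"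
  by (rule bounded_above_diagonalI [where m = 1]) auto

lift_definition F_mat :: imat is "\<lambda>j k. if j = k then fact k else 0"
  by (rule bounded_above_diagonalI [where m = 0]) auto

lemma lower_triangular_D: "lower_triangular D_mat"
  by (simp add: lower_triangular_def D_mat.rep_eq)

(* A composition matrix is only considered for f with zero constant term; the value 0 outside
   that case is a dummy. *)
lift_definition composition_mat :: "complex fps \<Rightarrow> imat" is
  "\<lambda>f k n. if fps_nth f 0 = 0 then fps_nth (f ^ n) k else 0"
proof (rule bounded_above_diagonalI [where m = 0])
  fix f :: "complex fps" and k n :: nat
  assume "int k - int n < 0"
  then show "(if fps_nth f 0 = 0 then fps_nth (f ^ n) k else 0) = 0"
    by (simp add: startsby_zero_power_prefix)
qed

(* With a(t) = \<Sum>k. a_k t^k / k!, the number a_k / k! is fps_nth a k. The sum is taken entrywise;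
   for each entry only finitely many terms are nonzero because D is strictly lower triangular. *)
lift_definition fps_at_D :: "complex fps \<Rightarrow> imat" is
  "\<lambda>a i j. Sum_any (\<lambda>k. fps_nth a k * entry (D_mat ^ k) i j)"
proof (rule bounded_above_diagonalI [where m = 0])
  fix a :: "complex fps" and i j :: nat
  assume "int i - int j < 0"
  then have "entry (D_mat ^ k) i j = 0" for k
    using lower_triangular_power [OF lower_triangular_D] by (simp add: lower_triangular_def)
  then show "Sum_any (\<lambda>k. fps_nth a k * entry (D_mat ^ k) i j) = 0"
    by simp
qed

end

(*
  Scaling rows and columns by factorials, a matrix acts on formal power series so that D is
  multiplication by z, X is d/dz, a(D) is multiplication by a, and F C_f F^-1 is substitution of f.
  Hence S sends h to (g h) o f, and the identities become the product and chain rules.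
*)
theory Submission
  imports Defs
begin

section \<open>The action of matrices on formal power series\<close>

text \<open>The series h is turned into the column of its exponential coefficients h_l * l!,
  multiplied by A, and turned back into a series. The weights match the factorials in the entries of
  D. Every row of A is finite, so any h is allowed.\<close>

definition action :: "imat \<Rightarrow> complex fps \<Rightarrow> complex fps" where
  "action A h = Abs_fps (\<lambda>i. (\<Sum>l | entry A i l \<noteq> 0. entry A i l * fps_nth h l * fact l) / fact i)"

lemma action_nth:
  assumes "finite R" "{l. entry A i l \<noteq> 0} \<subseteq> R"
  shows "fps_nth (action A h) i = (\<Sum>l\<in>R. entry A i l * fps_nth h l * fact l) / fact i"
proof -
  have "(\<Sum>l | entry A i l \<noteq> 0. entry A i l * fps_nth h l * fact l) =
      (\<Sum>l\<in>R. entry A i l * fps_nth h l * fact l)"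
    by (rule sum.mono_neutral_left) (use assms in auto)
  then show ?thesis
    by (simp add: action_def)
qed

lemma action_times: "action (A * B) h = action A (action B h)"
proof (rule fps_ext)
  fix i
  let ?R = "{l. entry A i l \<noteq> 0}"
  \<comment> \<open>One finite index set for all the sums: it contains the support of row i of
    \<open>A * B\<close> and of each row l of B that row i of A meets.\<close>
  let ?Q = "\<Union>l\<in>?R. {q. entry B l q \<noteq> 0}"
  have entry_AB: "entry (A * B) i q = (\<Sum>l\<in>?R. entry A i l * entry B l q)" for q
    by (rule entry_times) auto
  have sub: "{q. entry (A * B) i q \<noteq> 0} \<subseteq> ?Q"
  proof
    fix q
    assume "q \<in> {q. entry (A * B) i q \<noteq> 0}"
    then have "(\<Sum>l\<in>?R. entry A i l * entry B l q) \<noteq> 0"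
      by (simp add: entry_AB)
    then obtain l where "l \<in> ?R" "entry A i l * entry B l q \<noteq> 0"
      by (meson sum.neutral)
    then show "q \<in> ?Q" by auto
  qed
  have inner: "fps_nth (action B h) l * fact l = (\<Sum>q\<in>?Q. entry B l q * fps_nth h q * fact q)"
    if "l \<in> ?R" for l
    using that by (subst action_nth [of ?Q]) auto
  have "fps_nth (action (A * B) h) i = (\<Sum>q\<in>?Q. entry (A * B) i q * fps_nth h q * fact q) / fact i"
    by (rule action_nth [OF _ sub]) simp
  also have "(\<Sum>q\<in>?Q. entry (A * B) i q * fps_nth h q * fact q) =
      (\<Sum>q\<in>?Q. \<Sum>l\<in>?R. entry A i l * (entry B l q * fps_nth h q * fact q))"
    by (simp add: entry_AB sum_distrib_right mult.assoc)
  also have "\<dots> = (\<Sum>l\<in>?R. \<Sum>q\<in>?Q. entry A i l * (entry B l q * fps_nth h q * fact q))"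
    by (rule sum.swap)
  also have "\<dots> = (\<Sum>l\<in>?R. entry A i l * (fps_nth (action B h) l * fact l))"
    by (intro sum.cong refl) (simp only: inner sum_distrib_left)
  also have "\<dots> / fact i = fps_nth (action A (action B h)) i"
    by (subst action_nth [OF finite_row order_refl]) (simp add: mult.assoc)
  finally show "fps_nth (action (A * B) h) i = fps_nth (action A (action B h)) i" .
qed

lemma action_plus: "action (A + B) h = action A h + action B h"
proof (rule fps_ext)
  fix i
  let ?R = "{l. entry A i l \<noteq> 0} \<union> {l. entry B i l \<noteq> 0}"
  have "fps_nth (action C h) i = (\<Sum>l\<in>?R. entry C i l * fps_nth h l * fact l) / fact i"
    if "C \<in> {A, B, A + B}" for C
    using that by (intro action_nth) (auto simp: plus_imat.rep_eq)
  then show "fps_nth (action (A + B) h) i = fps_nth (action A h + action B h) i"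
    by (simp add: plus_imat.rep_eq sum.distrib add_divide_distrib algebra_simps)
qed

lemma action_one: "action 1 h = h"
proof (rule fps_ext)
  fix i
  have "fps_nth (action 1 h) i = (\<Sum>l\<in>{i}. entry 1 i l * fps_nth h l * fact l) / fact i"
    by (rule action_nth) (auto simp: one_imat.rep_eq)
  then show "fps_nth (action 1 h) i = fps_nth h i"
    by (simp add: one_imat.rep_eq)
qed

text \<open>The action is faithful: applied to \<open>fps_X ^ k\<close>, it returns column k with
  its entries rescaled by the nonzero factors k!/i!. Matrix identities thereby reduce to identities
  between power series.\<close>

lemma action_eqI:
  assumes "\<And>h. action A h = action B h"
  shows "A = B"
proof (rule imat_eqI)
  fix i k
  have "fps_nth (action C (fps_X ^ k)) i = entry C i k * fact k / fact i" for C
  proof -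
    let ?R = "insert k {l. entry C i l \<noteq> 0}"
    have "fps_nth (action C (fps_X ^ k)) i =
        (\<Sum>l\<in>?R. entry C i l * fps_nth (fps_X ^ k) l * fact l) / fact i"
      by (rule action_nth) auto
    also have "(\<Sum>l\<in>?R. entry C i l * fps_nth (fps_X ^ k) l * fact l) =
        (\<Sum>l\<in>?R. if l = k then entry C i k * fact k else 0)"
      by (intro sum.cong) auto
    also have "\<dots> = entry C i k * fact k"
      by (subst sum.delta) auto
    finally show ?thesis .
  qed
  from this [of A] this [of B] assms [of "fps_X ^ k"] show "entry A i k = entry B i k"
    by simp
qed

section \<open>The actions of X, D and a(D)\<close>

lemma action_X_mat: "action X_mat h = fps_deriv h"
proof (rule fps_ext)
  fix i
  have "fps_nth (action X_mat h) i = (\<Sum>l\<in>{Suc i}. entry X_mat i l * fps_nth h l * fact l) / fact i"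
    by (rule action_nth) (auto simp: X_mat.rep_eq)
  then show "fps_nth (action X_mat h) i = fps_nth (fps_deriv h) i"
    by (simp add: X_mat.rep_eq)
qed

lemma entry_D_mat_power:
  "entry (D_mat ^ k) i j = (if i = j + k then fact i / fact j else 0)"
proof (induction k arbitrary: i)
  case 0
  then show ?case by (simp add: one_imat.rep_eq)
next
  case (Suc k)
  \<comment> \<open>For i = 0 the truncated index \<open>i - 1\<close> is 0, which is harmless
    because row 0 of D vanishes.\<close>
  have "entry (D_mat ^ Suc k) i j = (\<Sum>l\<in>{i - 1}. entry D_mat i l * entry (D_mat ^ k) l j)"
    unfolding power_Suc by (rule entry_times) (auto simp: D_mat.rep_eq)
  then show ?case
    by (cases i) (auto simp: Suc.IH D_mat.rep_eq)
qed

lemma entry_fps_at_D: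
  "entry (fps_at_D a) i j = (if j \<le> i then fps_nth a (i - j) * fact i / fact j else 0)"
proof -
  have "entry (fps_at_D a) i j = (\<Sum>k\<in>{i - j}. fps_nth a k * entry (D_mat ^ k) i j)"
    unfolding fps_at_D.rep_eq
    by (rule Sum_any.expand_superset) (auto simp: entry_D_mat_power)
  then show ?thesis
    by (simp add: entry_D_mat_power)
qed

text \<open>The factor i!/l! in the entries of a(D) cancels against the weights of the action, and
  what remains is the Cauchy product.\<close>

lemma action_fps_at_D: "action (fps_at_D a) h = a * h"
proof (rule fps_ext)
  fix i
  have "fps_nth (action (fps_at_D a) h) i =
      (\<Sum>l\<in>{0..i}. entry (fps_at_D a) i l * fps_nth h l * fact l) / fact i"
    by (rule action_nth) (auto simp: entry_fps_at_D)
  also have "\<dots> = (\<Sum>l=0..i. fps_nth h l * fps_nth a (i - l))"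
    unfolding sum_divide_distrib by (intro sum.cong) (auto simp: entry_fps_at_D)
  also have "\<dots> = fps_nth (a * h) i"
    by (simp add: mult.commute [of a] fps_mult_nth)
  finally show "fps_nth (action (fps_at_D a) h) i = fps_nth (a * h) i" .
qed

lemma action_D_mat: "action D_mat h = fps_X * h"
proof -
  have D_eq: "D_mat = fps_at_D fps_X"
    by (rule imat_eqI) (auto simp: entry_fps_at_D D_mat.rep_eq fps_X_def)
  show ?thesis
    unfolding D_eq by (rule action_fps_at_D)
qed

section \<open>Inverses of lower triangular matrices\<close>

text \<open>In the product sum A kills the terms with l > n and B those with l < n.\<close>

lemma entry_times_diagonal:
  assumes "lower_triangular A" "lower_triangular B"
  shows "entry (A * B) n n = entry A n n * entry B n n"
proof -
  have "entry (A * B) n n = (\<Sum>l\<in>{..n}. entry A n l * entry B l n)"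
    by (rule entry_times) (use assms in \<open>auto simp: lower_triangular_def not_less [symmetric]\<close>)
  also have "\<dots> = (\<Sum>l\<in>{..n}. if l = n then entry A n n * entry B n n else 0)"
    using assms by (intro sum.cong) (auto simp: lower_triangular_def)
  finally show ?thesis by simp
qed

lemma lower_triangular_group_times:
  assumes "A \<in> carrier lower_triangular_group" "B \<in> carrier lower_triangular_group"
  shows "A * B \<in> carrier lower_triangular_group"
  using assms
  by (simp add: lower_triangular_group_def lower_triangular_times entry_times_diagonal)

lemma monoid_lower_triangular_group: "monoid lower_triangular_group"
  by (rule monoidI)
    (use lower_triangular_group_times in
      \<open>auto simp: lower_triangular_group_def lower_triangular_one one_imat.rep_eq mult.assoc\<close>)

text \<open>In \<open>HOL-Algebra\<close>, \<open>inv\<close> is a definite description. A two-sided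
  inverse in the carrier of a monoid is unique, so exhibiting one determines it.\<close>

lemma inv_lower_triangular_group_eqI:
  assumes "A \<in> carrier lower_triangular_group" "B \<in> carrier lower_triangular_group"
    and "A * B = 1" "B * A = 1"
  shows "inv\<^bsub>lower_triangular_group\<^esub> A = B"
  by (rule monoid.inv_unique' [OF monoid_lower_triangular_group, symmetric])
    (use assms in \<open>auto simp: lower_triangular_group_def\<close>)

lemma fps_at_D_in_lower_triangular_group:
  "fps_nth a 0 \<noteq> 0 \<Longrightarrow> fps_at_D a \<in> carrier lower_triangular_group"
  by (simp add: lower_triangular_group_def lower_triangular_def entry_fps_at_D)

section \<open>The conjugated composition matrix\<close>

lift_definition inverse_F_mat :: imat is "\<lambda>j k. if j = k then 1 / fact k else 0"
  by (rule bounded_above_diagonalI [where m = 0]) auto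

lemma entry_F_mat_times: "entry (F_mat * C) i j = fact i * entry C i j"
proof -
  have "entry (F_mat * C) i j = (\<Sum>l\<in>{i}. entry F_mat i l * entry C l j)"
    by (rule entry_times) (auto simp: F_mat.rep_eq)
  then show ?thesis by (simp add: F_mat.rep_eq)
qed

lemma entry_times_inverse_F_mat: "entry (C * inverse_F_mat) i j = entry C i j / fact j"
proof -
  let ?R = "insert j {l. entry C i l \<noteq> 0}"
  have "entry (C * inverse_F_mat) i j = (\<Sum>l\<in>?R. entry C i l * entry inverse_F_mat l j)"
    by (rule entry_times) auto
  also have "\<dots> = (\<Sum>l\<in>?R. if l = j then entry C i j / fact j else 0)"
    by (intro sum.cong) (auto simp: inverse_F_mat.rep_eq)
  also have "\<dots> = entry C i j / fact j"
    by (subst sum.delta) auto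
  finally show ?thesis .
qed

lemma inv_F_mat: "inv\<^bsub>lower_triangular_group\<^esub> F_mat = inverse_F_mat"
proof (rule inv_lower_triangular_group_eqI)
  show "F_mat \<in> carrier lower_triangular_group" "inverse_F_mat \<in> carrier lower_triangular_group"
    by (auto simp: lower_triangular_group_def lower_triangular_def F_mat.rep_eq
        inverse_F_mat.rep_eq)
  show "F_mat * inverse_F_mat = 1"
    by (rule imat_eqI) (simp add: entry_F_mat_times inverse_F_mat.rep_eq one_imat.rep_eq)
  show "inverse_F_mat * F_mat = 1"
  proof (rule imat_eqI)
    fix i j
    have "entry (inverse_F_mat * F_mat) i j = (\<Sum>l\<in>{i}. entry inverse_F_mat i l * entry F_mat l j)"
      by (rule entry_times) (auto simp: inverse_F_mat.rep_eq)
    then show "entry (inverse_F_mat * F_mat) i j = entry 1 i j"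
      by (simp add: inverse_F_mat.rep_eq F_mat.rep_eq one_imat.rep_eq)
  qed
qed

text \<open>This is the factor B of the Sheffer matrix, with the inverse of F written out.
  Conjugation by F passes from ordinary to exponential coefficients.\<close>

definition substitution_mat :: "complex fps \<Rightarrow> imat" where
  "substitution_mat f = F_mat * composition_mat f * inverse_F_mat"

lemma entry_substitution_mat:
  "fps_nth f 0 = 0 \<Longrightarrow> entry (substitution_mat f) i j = fact i * fps_nth (f ^ j) i / fact j"
  by (simp add: substitution_mat_def entry_times_inverse_F_mat entry_F_mat_times
      composition_mat.rep_eq)

text \<open>The factorials from F cancel the weights, leaving the sum of h_l times the coefficient
  of z^i in f^l. It stops at l = i because f^l has no terms of degree below l.\<close>

lemma action_substitution_mat:
  assumes "fps_nth f 0 = 0"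
  shows "action (substitution_mat f) h = h oo f"
proof (rule fps_ext)
  fix i
  have "fps_nth (action (substitution_mat f) h) i =
      (\<Sum>l\<in>{0..i}. entry (substitution_mat f) i l * fps_nth h l * fact l) / fact i"
    by (rule action_nth)
      (use assms in \<open>auto simp: entry_substitution_mat not_less [symmetric]
        startsby_zero_power_prefix\<close>)
  also have "\<dots> = fps_nth (h oo f) i"
    unfolding sum_divide_distrib fps_compose_nth
    by (intro sum.cong) (auto simp: entry_substitution_mat assms)
  finally show "fps_nth (action (substitution_mat f) h) i = fps_nth (h oo f) i" .
qed

text \<open>The diagonal entry at n is the n-th power of the linear coefficient of f.\<close>

lemma substitution_mat_in_lower_triangular_group:
  assumes "fps_nth f 0 = 0" "fps_nth f 1 \<noteq> 0"
  shows "substitution_mat f \<in> carrier lower_triangular_group"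
  using assms
  by (auto simp: lower_triangular_group_def lower_triangular_def entry_substitution_mat
      startsby_zero_power_prefix startsby_zero_power_nth_same)

section \<open>The Sheffer matrix\<close>

theorem mainTheorem4:
  fixes g f f_inv :: "complex fps" and A B S M\<^sub>S P\<^sub>S :: imat
  assumes "fps_nth g 0 \<noteq> 0"
    and "fps_nth f 0 = 0" and "fps_nth f 1 = 1"
    and "f_inv = fps_inv f"
    and "A = fps_at_D g"
    and "B = F_mat * composition_mat f * inv\<^bsub>lower_triangular_group\<^esub> F_mat"
    and "S = B * A"
    and "M\<^sub>S = inv\<^bsub>lower_triangular_group\<^esub> S * X_mat * S"
    and "P\<^sub>S = inv\<^bsub>lower_triangular_group\<^esub> S * D_mat * S"
  shows "M\<^sub>S = fps_at_D (1 / fps_deriv f_inv) * (fps_at_D (fps_deriv g / g) + X_mat)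
    \<and> P\<^sub>S = fps_at_D f_inv
    \<and> P\<^sub>S * M\<^sub>S = fps_at_D (f_inv / fps_deriv f_inv) * (fps_at_D (fps_deriv g / g) + X_mat)"
proof -
  have f_inv_0: "fps_nth f_inv 0 = 0" and f_inv_1: "fps_nth f_inv 1 = 1"
    using assms(3,4) by (simp_all add: fps_inv_def)
  have f_inv_f: "f_inv oo f = fps_X" and f_f_inv: "f oo f_inv = fps_X"
    using assms(2-4) by (simp_all add: fps_inv fps_inv_right)
  have cancel_f_inv: "(h oo f) oo f_inv = h" and cancel_f: "(h oo f_inv) oo f = h" for h
    by (simp_all add: fps_compose_assoc [symmetric] f_inv_0 assms(2) f_inv_f f_f_inv)
  \<comment> \<open>The formula for the derivative of a compositional inverse, with both sides
    inverted; the composite has constant term f_1 = 1, so it is a unit.\<close>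
  have deriv_f: "fps_deriv f oo f_inv = inverse (fps_deriv f_inv)"
    using assms(2-4) by (simp add: fps_inv_deriv fps_inverse_idempotent)
  have g_cancel: "inverse g * g = 1" "g * inverse g = 1"
    using assms(1) by (simp_all add: inverse_mult_eq_1 inverse_mult_eq_1')
  \<comment> \<open>A nonzero constant term makes division by this series the same as multiplication
    by its \<open>inverse\<close>.\<close>
  have deriv_f_inv_0: "fps_nth (fps_deriv f_inv) 0 \<noteq> 0"
    using f_inv_1 by simp

  have S_eq: "S = substitution_mat f * fps_at_D g"
    using assms(5-7) by (simp add: inv_F_mat substitution_mat_def)
  \<comment> \<open>S multiplies by g and then substitutes f; T undoes this in reverse order,
    substituting \<open>f_inv\<close> and then dividing by g.\<close>
  define T where "T = fps_at_D (inverse g) * substitution_mat f_inv"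
  have action_S: "action S h = (g * h) oo f" for h
    by (simp add: S_eq action_times action_fps_at_D action_substitution_mat assms(2))
  have action_T: "action T h = inverse g * (h oo f_inv)" for h
    by (simp add: T_def action_times action_fps_at_D action_substitution_mat f_inv_0)

  have inv_S: "inv\<^bsub>lower_triangular_group\<^esub> S = T"
  proof (rule inv_lower_triangular_group_eqI)
    show "S \<in> carrier lower_triangular_group" "T \<in> carrier lower_triangular_group"
      unfolding S_eq T_def using assms(1-3) f_inv_0 f_inv_1
      by (intro lower_triangular_group_times fps_at_D_in_lower_triangular_group
          substitution_mat_in_lower_triangular_group; simp)+
    show "S * T = 1"
      by (rule action_eqI)
        (simp add: action_times action_S action_T action_one mult.assoc [symmetric] g_cancel cancel_f)
    show "T * S = 1"
      by (rule action_eqI)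
        (simp add: action_times action_S action_T action_one mult.assoc [symmetric] g_cancel
          cancel_f_inv)
  qed

  have M: "M\<^sub>S = fps_at_D (1 / fps_deriv f_inv) * (fps_at_D (fps_deriv g / g) + X_mat)"
  proof (rule action_eqI)
    fix h
    have "action M\<^sub>S h = inverse g * (fps_deriv ((g * h) oo f) oo f_inv)"
      by (simp add: assms(8) inv_S action_times action_S action_T action_X_mat)
    \<comment> \<open>Chain rule: substituting \<open>f_inv\<close> restores (g h)' in the outer
      factor and turns the inner derivative f' into 1 / \<open>f_inv\<close>'.\<close>
    also have "fps_deriv ((g * h) oo f) oo f_inv = fps_deriv (g * h) * inverse (fps_deriv f_inv)"
      by (simp only: fps_compose_deriv [OF assms(2)] fps_compose_mult_distrib [OF f_inv_0]
          cancel_f_inv deriv_f)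
    \<comment> \<open>Product rule for g h; division by g leaves the logarithmic derivative g'/g as
      the coefficient of h.\<close>
    also have "inverse g * \<dots> =
        inverse (fps_deriv f_inv) * (fps_deriv g * inverse g * h + (inverse g * g) * fps_deriv h)"
      by (simp add: algebra_simps)
    also have "\<dots> = action (fps_at_D (1 / fps_deriv f_inv) * (fps_at_D (fps_deriv g / g) + X_mat)) h"
      using assms(1) deriv_f_inv_0
      by (simp add: g_cancel action_times action_plus action_fps_at_D action_X_mat fps_divide_unit)
    finally show "action M\<^sub>S h = \<dots>" .
  qed
  have P: "P\<^sub>S = fps_at_D f_inv"
  proof (rule action_eqI)
    fix h
    have "action P\<^sub>S h = inverse g * ((fps_X * ((g * h) oo f)) oo f_inv)"
      by (simp add: assms(9) inv_S action_times action_S action_T action_D_mat)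
    \<comment> \<open>D multiplies by z, and substituting \<open>f_inv\<close> sends this factor z
      to \<open>f_inv\<close>.\<close>
    also have "(fps_X * ((g * h) oo f)) oo f_inv = f_inv * (g * h)"
      by (simp only: fps_compose_mult_distrib [OF f_inv_0] cancel_f_inv
          fps_X_fps_compose_startby0 [OF f_inv_0])
    also have "inverse g * (f_inv * (g * h)) = (inverse g * g) * (f_inv * h)"
      by (simp only: mult_ac)
    finally show "action P\<^sub>S h = action (fps_at_D f_inv) h"
      by (simp add: g_cancel action_fps_at_D)
  qed
  \<comment> \<open>Both factors act by multiplication, so their product is the series in D given by
    the product of the two series.\<close>
  have "fps_at_D f_inv * fps_at_D (1 / fps_deriv f_inv) = fps_at_D (f_inv / fps_deriv f_inv)"
    by (rule action_eqI)
      (use deriv_f_inv_0 in \<open>simp add: action_times action_fps_at_D fps_divide_unit mult.assoc\<close>)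
  then have "P\<^sub>S * M\<^sub>S = fps_at_D (f_inv / fps_deriv f_inv) * (fps_at_D (fps_deriv g / g) + X_mat)"
    by (simp add: M P mult.assoc [symmetric])
  with M P show ?thesis by blast
qed

end
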